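(* Let $s\ge 1$, let $q_1,\dots,q_s\in(0,1)$ and $h_j=\log q_j<0$, and write $\boldsymbol h=(h_1,\dots,h_s)$. For $\alpha,\beta\in\mathbb C$, $$\Phi_{\boldsymbol h}(\alpha)=\Phi_{\boldsymbol h}(\beta)\quad\Longleftrightarrow\quad \alpha-\beta\in\Lambda(\boldsymbol h).$$ Moreover: (i) if $h_j/h_k\notin\mathbb Q$ for at least one pair $j\neq k$, then $\Lambda(\boldsymbol h)=\{0\}$ and $\Phi_{\boldsymbol h}$ is injective on $\mathbb C$; (ii) if $h_j=n_jd$ for $j=1,\dots,s$ with $d\ne0$ and nonzero relatively prime integers $n_1,\dots,n_s$ (that is, $\gcd(n_1,\dots,n_s)=1$), then $$\Lambda(\boldsymbol h)=\frac{2\pi i}{d}\mathbb Z.$$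
   Context: The joint scale embedding is $\Phi_{\boldsymbol h}:\mathbb C\to\mathbb C^s$, $\Phi_{\boldsymbol h}(\alpha)=(e^{h_1\alpha},\dots,e^{h_s\alpha})$. The joint aliasing lattice is $\Lambda(\boldsymbol h)=\{\delta\in\mathbb C:\ h_j\delta\in 2\pi i\mathbb Z\ \text{for } j=1,\dots,s\}$. *)

theory Defs
  imports "HOL-Analysis.Analysis"
begin

definition joint_scale_embedding :: "real ^ 's \<Rightarrow> complex \<Rightarrow> complex ^ 's"
  where "joint_scale_embedding h \<alpha> = (\<chi> j. exp (complex_of_real (h $ j) * \<alpha>))"

definition joint_aliasing_lattice :: "real ^ 's \<Rightarrow> complex set"
  where "joint_aliasing_lattice h =
    {\<delta>. \<forall>j. complex_of_real (h $ j) * \<delta> \<in> range (\<lambda>m::int. 2 * of_real pi * \<i> * of_int m)}"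

end

theory Submission
  imports Defs
begin

text \<open>
  A complex number \<open>\<delta>\<close> lies in the aliasing lattice of \<open>h\<close> exactly when every \<open>exp (h $ j * \<delta>)\<close>
  equals 1, so the fibres of the embedding are the cosets of the lattice.

  A nonzero lattice point \<open>\<delta>\<close> turns every ratio \<open>h $ j / h $ k\<close> into a ratio of the integers
  \<open>h $ j * \<delta> / (2 * pi * \<i>)\<close> and \<open>h $ k * \<delta> / (2 * pi * \<i>)\<close>, so a single irrational ratio
  leaves only 0 in the lattice (\<open>joint_aliasing_lattice_trivial\<close>).

  If \<open>h $ j = n j * d\<close>, put \<open>z = d * \<delta> / (2 * pi * \<i>)\<close>. Membership of \<open>\<delta>\<close> says that every
  \<open>n j * z\<close> is an integer. The integers \<open>a\<close> for which \<open>a * z\<close> is an integer form an ideal, which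
  contains the greatest common divisor of the \<open>n j\<close> by Bezout's identity (\<open>Gcd_mult_in_Ints\<close>).
  For coprime \<open>n j\<close> this means that \<open>z\<close> itself is an integer
  (\<open>joint_aliasing_lattice_commensurable\<close>).
\<close>

lemma joint_scale_embedding_eq_iff:
  "joint_scale_embedding h \<alpha> = joint_scale_embedding h \<beta>
     \<longleftrightarrow> \<alpha> - \<beta> \<in> joint_aliasing_lattice h"
proof -
  have "exp (complex_of_real (h $ j) * \<alpha>) = exp (complex_of_real (h $ j) * \<beta>)
      \<longleftrightarrow> complex_of_real (h $ j) * (\<alpha> - \<beta>) \<in> range (\<lambda>m::int. 2 * of_real pi * \<i> * of_int m)" for j
    by (auto simp: exp_eq image_iff algebra_simps)
  then show ?thesis
    by (simp add: joint_scale_embedding_def joint_aliasing_lattice_def vec_eq_iff)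
qed

lemma joint_aliasing_lattice_trivial:
  assumes irrational: "h $ j / h $ k \<notin> \<rat>"
  shows "joint_aliasing_lattice h = {0}"
proof -
  have "\<delta> = 0" if "\<delta> \<in> joint_aliasing_lattice h" for \<delta>
  proof (rule ccontr)
    assume "\<delta> \<noteq> 0"
    from that obtain a b :: int
      where a: "complex_of_real (h $ j) * \<delta> = 2 * of_real pi * \<i> * of_int a"
        and b: "complex_of_real (h $ k) * \<delta> = 2 * of_real pi * \<i> * of_int b"
      unfolding joint_aliasing_lattice_def by blast
    \<comment> \<open>If \<open>h $ k = 0\<close>, then \<open>b = 0\<close>, and the chain holds with every quotient equal to 0.\<close>
    have "complex_of_real (h $ j / h $ k)
        = (complex_of_real (h $ j) * \<delta>) / (complex_of_real (h $ k) * \<delta>)"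
      using \<open>\<delta> \<noteq> 0\<close> by simp
    also have "\<dots> = complex_of_real (of_int a / of_int b)"
      unfolding a b by simp
    finally have "h $ j / h $ k = of_int a / of_int b"
      by (simp only: of_real_eq_iff)
    with irrational show False by simp
  qed
  moreover have "0 \<in> joint_aliasing_lattice h"
    by (auto simp: joint_aliasing_lattice_def image_iff)
  ultimately show ?thesis by blast
qed

text \<open>
  The multipliers that send \<open>z\<close> into the integers are closed under integer linear combinations,
  hence, by Bezout's identity applied one element at a time, under greatest common divisors.
\<close>

lemma Gcd_mult_in_Ints:
  fixes z :: "'a::ring_1" and A :: "int set"
  assumes "finite A" and "\<And>a. a \<in> A \<Longrightarrow> of_int a * z \<in> \<int>"
  shows "of_int (Gcd A) * z \<in> \<int>"
  using assms
proof (induction A rule: finite_induct)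
  case empty
  then show ?case by simp
next
  case (insert a A)
  obtain u v where uv: "u * a + v * Gcd A = gcd a (Gcd A)"
    using bezout_int by blast
  have "of_int (Gcd (insert a A)) * z = of_int u * (of_int a * z) + of_int v * (of_int (Gcd A) * z)"
    by (simp add: uv[symmetric] distrib_right mult.assoc)
  also have "\<dots> \<in> \<int>"
    by (rule Ints_add; rule Ints_mult[OF Ints_of_int]; simp add: insert)
  finally show ?case .
qed

lemma joint_aliasing_lattice_commensurable:
  fixes h :: "real ^ 's" and n :: "'s \<Rightarrow> int"
  assumes d: "d \<noteq> 0" and coprime: "Gcd (range n) = 1"
    and h: "\<And>j. h $ j = of_int (n j) * d"
  shows "joint_aliasing_lattice h
    = range (\<lambda>m::int. (2 * of_real pi * \<i> / complex_of_real d) * of_int m)"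
proof (intro equalityI subsetI)
  fix \<delta> assume \<delta>: "\<delta> \<in> joint_aliasing_lattice h"
  define z where "z = complex_of_real d * \<delta> / (2 * of_real pi * \<i>)"
  have "of_int (n j) * z \<in> \<int>" for j
  proof -
    from \<delta> obtain m :: int where "complex_of_real (h $ j) * \<delta> = 2 * of_real pi * \<i> * of_int m"
      unfolding joint_aliasing_lattice_def by blast
    then have "of_int (n j) * z = of_int m"
      by (simp add: z_def h field_simps)
    then show ?thesis by simp
  qed
  then have "of_int (Gcd (range n)) * z \<in> \<int>"
    by (intro Gcd_mult_in_Ints) auto
  then obtain m where "z = of_int m"
    by (auto simp: coprime elim: Ints_cases)
  then have "\<delta> = (2 * of_real pi * \<i> / complex_of_real d) * of_int m"
    using d by (simp add: z_def field_simps)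
  then show "\<delta> \<in> range (\<lambda>m::int. (2 * of_real pi * \<i> / complex_of_real d) * of_int m)"
    by blast
next
  fix \<delta> assume "\<delta> \<in> range (\<lambda>m::int. (2 * of_real pi * \<i> / complex_of_real d) * of_int m)"
  then obtain m :: int where m: "\<delta> = (2 * of_real pi * \<i> / complex_of_real d) * of_int m"
    by blast
  have "complex_of_real (h $ j) * \<delta> = 2 * of_real pi * \<i> * of_int (n j * m)" for j
    using d by (simp add: m h)
  then show "\<delta> \<in> joint_aliasing_lattice h"
    unfolding joint_aliasing_lattice_def by blast
qed

theorem theorem3p2:
  fixes q h :: "real ^ 's"
  assumes q: "\<And>j. 0 < q $ j \<and> q $ j < 1"
    and h: "\<And>j. h $ j = ln (q $ j)"
  shows "(\<forall>\<alpha> \<beta> :: complex.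
            joint_scale_embedding h \<alpha> = joint_scale_embedding h \<beta>
              \<longleftrightarrow> \<alpha> - \<beta> \<in> joint_aliasing_lattice h)
    \<and> ((\<exists>j k. j \<noteq> k \<and> h $ j / h $ k \<notin> \<rat>) \<longrightarrow>
          joint_aliasing_lattice h = {0} \<and> inj (joint_scale_embedding h))
    \<and> (\<forall>(d :: real) (n :: 's \<Rightarrow> int).
          d \<noteq> 0 \<and> (\<forall>j. n j \<noteq> 0) \<and> Gcd (range n) = 1 \<and> (\<forall>j. h $ j = of_int (n j) * d) \<longrightarrow>
          joint_aliasing_lattice h
            = range (\<lambda>m::int. (2 * of_real pi * \<i> / complex_of_real d) * of_int m))"
proof (intro conjI allI impI)
  assume "\<exists>j k. j \<noteq> k \<and> h $ j / h $ k \<notin> \<rat>"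
  then show trivial: "joint_aliasing_lattice h = {0}"
    using joint_aliasing_lattice_trivial by blast
  show "inj (joint_scale_embedding h)"
    by (rule injI) (simp add: joint_scale_embedding_eq_iff trivial)
qed (use joint_scale_embedding_eq_iff joint_aliasing_lattice_commensurable in blast)+

end
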